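(* Let $\lambda$ be a nonzero real number, let $n\ge 0$, and let $p(x)\in\mathbb{C}[x]$ with $\deg p(x)\le n$. Then \[ p(x)=\sum_{m=0}^n a_m\, b_{m,\lambda}(x),\qquad\text{where}\qquad a_m=\frac{1}{m!}\Big\langle (2-e^t)\Big(\tfrac{1}{\lambda}(e^{\lambda t}-1)\Big)^m \,\Big|\, p(x)\Big\rangle . \]
   Context: For a nonzero real $\lambda$, the degenerate ordered Bell polynomials $b_{n,\lambda}(x)$ are defined by the formal power series identity \[ \frac{1}{2-(1+\lambda t)^{1/\lambda}}(1+\lambda t)^{x/\lambda}=\sum_{n=0}^\infty b_{n,\lambda}(x)\frac{t^n}{n!}, \] where $(1+\lambda t)^{a/\lambda}=\exp\big(\tfrac{a}{\lambda}\log(1+\lambda t)\big)$. For a formal power series $f(t)=\sum_{k\ge0}c_k\frac{t^k}{k!}\in\mathbb{C}[[t]]$ and a polynomial $p(x)=\sum_{k} d_k x^k\in\mathbb{C}[x]$, the pairing $\langle f(t)\mid p(x)\rangle$ is the linear functional defined by $\langle f(t)\mid x^k\rangle=c_k$, i.e. $\langle f(t)\mid p(x)\rangle=\sum_k c_k d_k$; equivalently $\langle t^k\mid x^n\rangle=n!\,\delta_{n,k}$. *)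

theory Defs
  imports "HOL-Computational_Algebra.Computational_Algebra" Complex_Main
begin

definition fps_log1p :: "real \<Rightarrow> complex fps" where
  \<comment> \<open>log (1 + lam t)\<close>
  "fps_log1p lam = fps_ln 1 oo (fps_const (of_real lam) * fps_X)"

definition degen_exp :: "real \<Rightarrow> complex \<Rightarrow> complex fps" where
  \<comment> \<open>(1 + lam t) to the power a / lam, i.e. exp ((a / lam) log (1 + lam t))\<close>
  "degen_exp lam a = fps_exp 1 oo (fps_const (a / of_real lam) * fps_log1p lam)"

text \<open>
  For an indeterminate exponent x the series lives in C[x][[t]], represented as
  \<^typ>\<open>complex poly fps\<close>; series over C are embedded coefficientwise.
\<close>

definition fps_lift_poly :: "complex fps \<Rightarrow> complex poly fps" where
  "fps_lift_poly f = Abs_fps (\<lambda>k. [:f $ k:])"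

definition degen_exp_X :: "real \<Rightarrow> complex poly fps" where
  \<comment> \<open>exp ((x / lam) log (1 + lam t)) with x the indeterminate of the polynomial ring\<close>
  "degen_exp_X lam =
     fps_lift_poly (fps_exp 1) oo
       (fps_const [:0, 1 / of_real lam:] * fps_lift_poly (fps_log1p lam))"

definition degen_ordered_bell :: "real \<Rightarrow> nat \<Rightarrow> complex poly" where
  \<comment> \<open>the constant term of the inverted series is 1, so this is a genuine inverse in C[[t]]\<close>
  "degen_ordered_bell lam n =
     smult (fact n)
       ((fps_lift_poly (inverse (2 - degen_exp lam 1)) * degen_exp_X lam) $ n)"

definition umbral_pairing :: "complex fps \<Rightarrow> complex poly \<Rightarrow> complex" where
  \<comment> \<open>fact k * f $ k is the coefficient of t^k / k! in f\<close>
  "umbral_pairing f p = (\<Sum>k\<le>degree p. (fact k * f $ k) * coeff p k)"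

text \<open>
  The definitions agree with the usual characterisations: the generating function identity
  (for every complex value of x) and the values of the pairing on monomials.
\<close>

lemma poly_fps_power_nth:
  "poly ((g ^ i) $ n) x = (Abs_fps (\<lambda>k. poly (g $ k) x) ^ i) $ n"
  by (induction i arbitrary: n) (simp_all add: fps_mult_nth poly_sum)

lemma poly_degen_exp_X_nth:
  "poly (degen_exp_X lam $ n) x = degen_exp lam x $ n"
proof -
  have "Abs_fps (\<lambda>k. poly ((fps_const [:0, 1 / of_real lam:] * fps_lift_poly (fps_log1p lam)) $ k) x)
      = fps_const (x / of_real lam) * fps_log1p lam"
    by (rule fps_ext) (simp add: fps_lift_poly_def)
  then show ?thesis
    by (simp add: degen_exp_X_def degen_exp_def fps_compose_nth poly_sum poly_fps_power_nth
                  fps_lift_poly_def[of "fps_exp 1"] del: fps_mult_left_const_nth)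
qed

lemma degen_exp_nth_0: "degen_exp lam a $ 0 = 1"
  by (simp add: degen_exp_def)

lemma degen_ordered_bell_generating_function:
  "1 / (2 - degen_exp lam 1) * degen_exp lam x
     = Abs_fps (\<lambda>n. poly (degen_ordered_bell lam n) x / fact n)"
proof (rule fps_ext)
  fix n
  have "(2 - degen_exp lam 1) $ 0 \<noteq> 0"
    by (simp add: degen_exp_nth_0 fps_numeral_nth)
  then have "1 / (2 - degen_exp lam 1) = inverse (2 - degen_exp lam 1)"
    by (simp add: fps_divide_unit)
  then show "(1 / (2 - degen_exp lam 1) * degen_exp lam x) $ n
      = Abs_fps (\<lambda>n. poly (degen_ordered_bell lam n) x / fact n) $ n"
    by (simp add: degen_ordered_bell_def fps_mult_nth poly_sum poly_degen_exp_X_nth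
                  fps_lift_poly_def)
qed

lemma umbral_pairing_monom:
  "umbral_pairing (fps_X ^ k) (monom 1 n) = (if n = k then fact n else 0)"
proof -
  have "umbral_pairing (fps_X ^ k) (monom 1 n)
      = (\<Sum>j\<le>n. if j = n then (if n = k then fact n else 0) else 0)"
    unfolding umbral_pairing_def
    by (rule sum.cong) (auto simp: degree_monom_eq fps_X_power_nth)
  then show ?thesis
    by simp
qed

end

theory Submission
  imports Defs
begin

text \<open>
  The series \<open>g = (e\<^bsup>\<lambda>t\<^esup> - 1) / \<lambda>\<close> is the compositional inverse of \<open>log (1 + \<lambda>t) / \<lambda>\<close>, so substituting
  \<open>g\<close> for \<open>t\<close> in the generating function and multiplying by \<open>2 - e\<^sup>t\<close> yields
  \<open>(\<Sum>m. b\<^sub>m(x) / m! * (2 - e\<^sup>t) * g\<^sup>m) = e\<^bsup>xt\<^esup>\<close>. Since \<open>\<langle>e\<^bsup>xt\<^esup> | p\<rangle> = p(x)\<close>, pairing both sides with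
  \<open>p\<close> gives the expansion; it is finite because \<open>g\<^sup>m\<close> has order \<open>m\<close>.
\<close>

text \<open>Rescaling the variable by \<open>c\<close> turns \<open>fps_exp 1 - 1\<close> into
  \<open>fps_exp c - 1\<close>, so only the inverse pair for \<open>c = 1\<close> is needed.\<close>

lemma fps_ln_compose_exp:
  "fps_ln 1 oo (fps_exp c - 1) = fps_const c * (fps_X :: 'a :: field_char_0 fps)"
proof -
  have "fps_exp c - 1 = (fps_exp 1 - 1) oo (fps_const c * (fps_X :: 'a fps))"
    by (simp add: fps_compose_sub_distrib)
  then have "fps_ln 1 oo (fps_exp c - 1)
      = (fps_ln 1 oo (fps_exp 1 - 1)) oo (fps_const c * (fps_X :: 'a fps))"
    by (simp add: fps_compose_assoc)
  also have "fps_ln 1 oo (fps_exp 1 - 1) = (fps_X :: 'a fps)"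
    by (simp add: fps_ln_fps_exp_inv fps_inv_fps_exp_compose)
  finally show ?thesis
    by (simp add: fps_X_fps_compose_startby0)
qed

definition degen_log_inv :: "real \<Rightarrow> complex fps" where
  "degen_log_inv lam = fps_const (1 / of_real lam) * (fps_exp (of_real lam) - 1)"

lemma degen_log_inv_nth_0 [simp]: "degen_log_inv lam $ 0 = 0"
  by (simp add: degen_log_inv_def)

lemma fps_log1p_compose_degen_log_inv:
  assumes "lam \<noteq> 0"
  shows "fps_log1p lam oo degen_log_inv lam = fps_const (of_real lam) * fps_X"
proof -
  have "(fps_const (of_real lam) * fps_X) oo degen_log_inv lam = fps_exp (of_real lam) - 1"
    using assms
    by (simp add: fps_compose_mult_distrib fps_X_fps_compose_startby0)
       (simp add: degen_log_inv_def mult.assoc[symmetric])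
  then show ?thesis
    by (simp add: fps_log1p_def fps_compose_assoc[symmetric] fps_ln_compose_exp)
qed

lemma degen_exp_compose_degen_log_inv:
  assumes "lam \<noteq> 0"
  shows "degen_exp lam a oo degen_log_inv lam = fps_exp a"
proof -
  have "(fps_const (a / of_real lam) * fps_log1p lam) oo degen_log_inv lam = fps_const a * fps_X"
    using assms
    by (simp add: fps_compose_mult_distrib fps_log1p_compose_degen_log_inv mult.assoc[symmetric])
  moreover have "(fps_const (a / of_real lam) * fps_log1p lam) $ 0 = 0"
    by (simp add: fps_log1p_def)
  ultimately show ?thesis
    by (simp add: degen_exp_def fps_compose_assoc[symmetric])
qed

lemma degen_ordered_bell_gf_compose:
  assumes "lam \<noteq> 0"
  shows "(2 - fps_exp 1) * (Abs_fps (\<lambda>m. poly (degen_ordered_bell lam m) x / fact m)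
           oo degen_log_inv lam) = fps_exp x"
proof -
  let ?d = "2 - degen_exp lam 1"
  have d0: "?d $ 0 \<noteq> 0"
    by (simp add: degen_exp_nth_0 fps_numeral_nth)
  \<comment> \<open>Clearing the denominator before substituting leaves only differences and
    products to compose, never an inverse.\<close>
  have "?d * Abs_fps (\<lambda>m. poly (degen_ordered_bell lam m) x / fact m)
      = (?d * inverse ?d) * degen_exp lam x"
    unfolding degen_ordered_bell_generating_function[symmetric]
    by (simp only: fps_divide_unit[OF d0] mult_1_left mult.assoc)
  also have "?d * inverse ?d = 1"
    using d0 by (rule inverse_mult_eq_1')
  finally have "(?d * Abs_fps (\<lambda>m. poly (degen_ordered_bell lam m) x / fact m))
      oo degen_log_inv lam = degen_exp lam x oo degen_log_inv lam"
    by simp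
  then show ?thesis
    by (simp add: fps_compose_mult_distrib fps_compose_sub_distrib
                  degen_exp_compose_degen_log_inv[OF assms])
qed

lemma fps_mult_compose_nth:
  fixes f h g :: "'a :: idom fps"
  assumes "g $ 0 = 0" and "k \<le> n"
  shows "(h * (f oo g)) $ k = (\<Sum>m=0..n. f $ m * (h * g ^ m) $ k)"
proof -
  \<comment> \<open>The sum for the composition stops at \<open>i\<close>; the terms added up to
    \<open>n\<close> vanish because \<open>g ^ m\<close> has order at least \<open>m\<close>. A
    bound independent of \<open>i\<close> lets the sums be swapped.\<close>
  have "(f oo g) $ i = (\<Sum>m=0..n. f $ m * (g ^ m) $ i)" if "i \<le> k" for i
    unfolding fps_compose_nth using that assms
    by (intro sum.mono_neutral_left) (auto simp: startsby_zero_power_prefix)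
  then have "(h * (f oo g)) $ k
      = (\<Sum>i=0..k. \<Sum>m=0..n. f $ m * (h $ i * (g ^ m) $ (k - i)))"
    by (simp add: fps_mult_nth sum_distrib_left mult.left_commute)
  also have "\<dots> = (\<Sum>m=0..n. f $ m * (h * g ^ m) $ k)"
    by (subst sum.swap) (simp add: fps_mult_nth sum_distrib_left)
  finally show ?thesis .
qed

lemma umbral_pairing_exp: "umbral_pairing (fps_exp x) p = poly p x"
  by (simp add: umbral_pairing_def poly_altdef mult.commute)

text \<open>The pairing sees only coefficients up to \<open>degree p\<close>, so the infinite
  expansion in powers of \<open>g\<close> may be cut off at \<open>n\<close> and paired
  termwise.\<close>

lemma umbral_pairing_mult_compose:
  assumes "g $ 0 = 0" and "degree p \<le> n"
  shows "umbral_pairing (h * (f oo g)) p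
      = (\<Sum>m=0..n. f $ m * umbral_pairing (h * g ^ m) p)"
proof -
  have "umbral_pairing (h * (f oo g)) p
      = (\<Sum>k\<le>degree p. \<Sum>m=0..n. f $ m * (fact k * (h * g ^ m) $ k * coeff p k))"
    unfolding umbral_pairing_def
    using assms by (intro sum.cong refl)
      (simp add: fps_mult_compose_nth[where n = n] sum_distrib_left sum_distrib_right mult_ac)
  also have "\<dots> = (\<Sum>m=0..n. f $ m * umbral_pairing (h * g ^ m) p)"
    by (subst sum.swap) (simp add: umbral_pairing_def sum_distrib_left)
  finally show ?thesis .
qed

theorem theorem8:
  fixes lam :: real and n :: nat and p :: "complex poly"
  assumes "lam \<noteq> 0" and "degree p \<le> n"
  shows "p = (\<Sum>m=0..n.
           smult
             (1 / fact m *
              umbral_pairing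
                ((2 - fps_exp 1) *
                 (fps_const (1 / of_real lam) * (fps_exp (of_real lam) - 1)) ^ m) p)
             (degen_ordered_bell lam m))"
proof -
  \<comment> \<open>The generating function is available for each complex value \<open>x\<close>, so
    the identity is proved pointwise and lifted to polynomials by \<open>poly_ext\<close>.\<close>
  have "poly p x = (\<Sum>m=0..n. poly (degen_ordered_bell lam m) x / fact m *
      umbral_pairing ((2 - fps_exp 1) * degen_log_inv lam ^ m) p)" for x
    using umbral_pairing_mult_compose[OF degen_log_inv_nth_0[of lam] assms(2), where h = "2 - fps_exp 1"
        and f = "Abs_fps (\<lambda>m. poly (degen_ordered_bell lam m) x / fact m)"]
    by (simp add: degen_ordered_bell_gf_compose[OF assms(1)] umbral_pairing_exp)
  then show ?thesis
    unfolding degen_log_inv_def[symmetric]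
    by (intro poly_ext) (simp add: poly_sum mult_ac)
qed

end
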